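(* Let $H=\langle V,E\rangle$ be a finite simple graph with $N=|V|$ vertices and maximum degree $\delta\geq 1$, let $R\subset E$ with $r=|R|$, and let $H'=H-R$ be the partial graph with the same vertex set $V$ and edge set $E\setminus R$. Let $\beta_1\ge\beta_2\ge\dots\ge\beta_N$ and $\beta_1'\ge\beta_2'\ge\dots\ge\beta_N'$ be the eigenvalues (with multiplicity, in non-increasing order) of the transition matrices $A$ and $A'$ of the regularised random walks on $H$ and $H'$, respectively. Then for all $j\in\{1,\dots,N\}$, $$\beta_j\;\le\;\beta_j'\;\le\;\beta_{\max\{j-r,\,1\}} .$$
   Context: The regularised random walk on a finite simple graph with vertex degrees at most $\delta$ is the simple random walk on the graph obtained by attaching loops to vertices (each loop increasing the degree of its vertex by one) until every vertex has degree $\delta$. If the graph has adjacency matrix $\mathcal A$ and diagonal degree matrix $D$, its transition matrix is $\delta^{-1}(\mathcal A+\delta I-D)$. Both walks (on $H$ and on $H'$) are regularised to the same degree $\delta$, the maximum degree of $H$. *)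

theory Defs
  imports "HOL-Library.Multiset" "Jordan_Normal_Form.Char_Poly"
begin

text \<open>
  A graph is given by its vertex set \<open>V\<close> and a set \<open>E\<close> of undirected edges, each a two-element
  subset of \<open>V\<close>; so there are no loops and no multiple edges, and \<open>card E\<close> counts undirected edges.
\<close>

definition finite_simple_graph :: "'v set \<Rightarrow> 'v set set \<Rightarrow> bool" where
  "finite_simple_graph V E \<longleftrightarrow> finite V \<and> (\<forall>e\<in>E. e \<subseteq> V \<and> card e = 2)"

definition vdegree :: "'v set set \<Rightarrow> 'v \<Rightarrow> nat" where
  "vdegree E v = card {e \<in> E. v \<in> e}"

definition max_degree :: "'v set \<Rightarrow> 'v set set \<Rightarrow> nat" where
  "max_degree V E = Max (vdegree E ` V)"

text \<open>
  Matrices are indexed by natural numbers, hence they are taken with respect to a repetition-free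
  list \<open>vs\<close> of the vertices.
\<close>

definition adjacency_mat :: "'v list \<Rightarrow> 'v set set \<Rightarrow> real mat" where
  "adjacency_mat vs E =
    mat (length vs) (length vs) (\<lambda>(i, j). if {vs ! i, vs ! j} \<in> E then 1 else 0)"

definition degree_mat :: "'v list \<Rightarrow> 'v set set \<Rightarrow> real mat" where
  "degree_mat vs E =
    mat (length vs) (length vs) (\<lambda>(i, j). if i = j then real (vdegree E (vs ! i)) else 0)"

definition regularised_walk_mat :: "nat \<Rightarrow> 'v list \<Rightarrow> 'v set set \<Rightarrow> real mat" where
  "regularised_walk_mat \<delta> vs E =
    inverse (real \<delta>) \<cdot>\<^sub>m
      (adjacency_mat vs E + real \<delta> \<cdot>\<^sub>m 1\<^sub>m (length vs) - degree_mat vs E)"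

text \<open>
  The \<open>j\<close>-th largest eigenvalue, for \<open>j\<close> starting at 1. Eigenvalues are repeated according to their
  multiplicity as roots of the characteristic polynomial. Only real roots are listed; for the
  symmetric matrices considered here these are all the roots.
\<close>

definition nth_eigenvalue :: "real mat \<Rightarrow> nat \<Rightarrow> real" where
  "nth_eigenvalue A j = rev (sorted_list_of_multiset (proots (char_poly A))) ! (j - 1)"

text \<open>
  \<open>regularised_walk_mat\<close> is the transition matrix of the simple random walk on the graph with loops
  attached. In that graph \<open>looped_mult \<delta> E u v\<close> is the number of edges (for \<open>u = v\<close>: of loops)
  between \<open>u\<close> and \<open>v\<close>, where a loop contributes one to the degree of its vertex.
\<close>

definition looped_mult :: "nat \<Rightarrow> 'v set set \<Rightarrow> 'v \<Rightarrow> 'v \<Rightarrow> nat" where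
  "looped_mult \<delta> E u v = (if u = v then \<delta> - vdegree E u else if {u, v} \<in> E then 1 else 0)"

lemma vdegree_eq_card_neighbours:
  assumes "finite_simple_graph V E"
  shows "vdegree E u = card {v \<in> V. {u, v} \<in> E}"
proof -
  have "bij_betw (\<lambda>v. {u, v}) {v \<in> V. {u, v} \<in> E} {e \<in> E. u \<in> e}"
  proof (rule bij_betwI')
    fix x y show "({u, x} = {u, y}) = (x = y)" by (auto simp: doubleton_eq_iff)
  next
    fix e assume e: "e \<in> {e \<in> E. u \<in> e}"
    then have "card e = 2" "e \<subseteq> V" using assms by (auto simp: finite_simple_graph_def)
    then obtain a b where "e = {a, b}" by (auto simp: card_2_iff)
    then show "\<exists>x\<in>{v \<in> V. {u, v} \<in> E}. e = {u, x}"
      using e \<open>e \<subseteq> V\<close> by (auto simp: insert_commute)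
  qed auto
  then show ?thesis by (simp add: vdegree_def bij_betw_same_card)
qed

lemma looped_degree:
  assumes "finite_simple_graph V E" "u \<in> V" "vdegree E u \<le> \<delta>"
  shows "(\<Sum>v\<in>V. looped_mult \<delta> E u v) = \<delta>"
proof -
  have fin: "finite V" and ns: "{u} \<notin> E"
    using assms(1) by (auto simp: finite_simple_graph_def)
  have "(\<Sum>v\<in>V. looped_mult \<delta> E u v) = (\<delta> - vdegree E u) + (\<Sum>v\<in>V - {u}. looped_mult \<delta> E u v)"
    using fin assms(2) by (simp add: sum.remove[of V u] looped_mult_def)
  also have "(\<Sum>v\<in>V - {u}. looped_mult \<delta> E u v) = (\<Sum>v\<in>V - {u}. if {u, v} \<in> E then 1 else 0)"
    by (rule sum.cong) (auto simp: looped_mult_def)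
  also have "\<dots> = card {v \<in> V - {u}. {u, v} \<in> E}"
    using fin by (simp add: sum.If_cases Int_def)
  also have "{v \<in> V - {u}. {u, v} \<in> E} = {v \<in> V. {u, v} \<in> E}"
    using ns by auto
  finally show ?thesis
    using assms(3) vdegree_eq_card_neighbours[OF assms(1), of u] by simp
qed

lemma regularised_walk_mat_eq_simple_walk:
  assumes "finite_simple_graph V E" "distinct vs" "set vs = V"
    and "\<And>v. v \<in> V \<Longrightarrow> vdegree E v \<le> \<delta>" "\<delta> \<ge> 1" "i < length vs" "j < length vs"
  shows "regularised_walk_mat \<delta> vs E $$ (i, j) =
    real (looped_mult \<delta> E (vs ! i) (vs ! j)) / real (\<Sum>v\<in>V. looped_mult \<delta> E (vs ! i) v)"
proof -
  have iV: "vs ! i \<in> V" using assms by auto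
  have ns: "{vs ! i} \<notin> E" using assms(1) by (auto simp: finite_simple_graph_def)
  have eq: "vs ! i = vs ! j \<longleftrightarrow> i = j" using assms by (simp add: nth_eq_iff_index_eq)
  show ?thesis
    unfolding looped_degree[OF assms(1) iV assms(4)[OF iV]]
    using assms(4)[OF iV] assms(5-7) ns eq
    by (auto simp: regularised_walk_mat_def adjacency_mat_def degree_mat_def looped_mult_def
        of_nat_diff field_simps)
qed

end

theory Submission
  imports Defs "Jordan_Normal_Form.Schur_Decomposition"
begin

text \<open>
  The quadratic form of the walk matrix is $|x|^2 - \frac{1}{\delta} \sum_{uv \in E} (x_u - x_v)^2$.
  Deleting edges can only increase it, and leaves it unchanged on the subspace cut out by the $r$
  equations $x_u = x_v$, $uv \in R$. Counting dimensions in the orthonormal eigenbases of $A$ and $A'$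
  turns the first fact into $\beta_j \le \beta'_j$ and the second into $\beta'_j \le \beta_{j-r}$ for
  $j > r$. For $j \le r$ the quadratic forms are at most $|x|^2$, so that $\beta'_j \le 1$, while the
  constant vector shows $\beta_1 \ge 1$.
\<close>

section \<open>Orthogonal diagonalisation and spectral expansion of real symmetric matrices\<close>

lemma scalar_prod_self_nonneg: "x \<bullet> x \<ge> (0 :: real)"
  by (auto simp: scalar_prod_def intro!: sum_nonneg)

lemma scalar_prod_self_pos:
  fixes x :: "real vec"
  assumes "x \<in> carrier_vec n" "x \<noteq> 0\<^sub>v n"
  shows "x \<bullet> x > 0"
  using conjugate_square_greater_0_vec[OF assms(1)] assms(2) by simp

text \<open>Complete \<open>v\<close> to a basis, orthogonalise by Gram-Schmidt, which keeps the
  first vector, and normalise; so \<open>c\<close> is the reciprocal of the norm of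
  \<open>v\<close>. This supplies the change of basis that splits off an eigenvector.\<close>

lemma ex_orthogonal_mat_with_first_col:
  fixes v :: "real vec"
  assumes v: "v \<in> carrier_vec n" and v0: "v \<noteq> 0\<^sub>v n"
  shows "\<exists>W \<in> carrier_mat n n. \<exists>c. W\<^sup>T * W = 1\<^sub>m n \<and> col W 0 = c \<cdot>\<^sub>v v"
proof -
  interpret cof_vec_space n "TYPE(real)" .
  define b where "b = basis_completion v"
  define ws where "ws = gram_schmidt n b"
  from basis_completion[OF v v0, folded b_def]
  have b: "distinct b" "\<not> lin_dep (set b)" "set b \<subseteq> carrier_vec n" "hd b = v" "length b = n"
    by auto
  have n: "n \<noteq> 0" using v v0 by (auto intro!: eq_vecI)
  then obtain vs where bv: "b = v # vs" using b by (cases b) auto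
  from gram_schmidt_result[OF b(3,1,2) refl, folded ws_def] b(5)
  have ws: "set ws \<subseteq> carrier_vec n" "corthogonal ws" "length ws = n" by auto
  have hd_ws: "ws ! 0 = v"
    using gram_schmidt_hd[OF v, of vs, folded bv] ws n unfolding ws_def
    by (metis hd_conv_nth length_0_conv)
  have cw: "ws ! i \<in> carrier_vec n" if "i < n" for i using ws that by auto
  have orth: "ws ! i \<bullet> ws ! j = 0 \<longleftrightarrow> i \<noteq> j" if "i < n" "j < n" for i j
    using corthogonalD[OF ws(2)] that ws(3) by simp
  \<comment> \<open>The inverse norms. They are well defined because \<open>orth\<close> is an
    equivalence: it also says that no \<open>ws ! i\<close> is isotropic.\<close>
  define s where "s i = 1 / sqrt (ws ! i \<bullet> ws ! i)" for i
  have s: "s i * s i * (ws ! i \<bullet> ws ! i) = 1" if "i < n" for i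
  proof -
    have "ws ! i \<bullet> ws ! i > 0"
      using orth[OF that that] scalar_prod_self_nonneg[of "ws ! i"] by simp
    then show ?thesis by (simp add: s_def)
  qed
  define W where "W = mat_of_cols n (map (\<lambda>i. s i \<cdot>\<^sub>v ws ! i) [0..<n])"
  have W: "W \<in> carrier_mat n n" by (auto simp: W_def)
  have col: "col W i = s i \<cdot>\<^sub>v ws ! i" if "i < n" for i
    unfolding W_def using that cw by simp
  have "W\<^sup>T * W = 1\<^sub>m n"
  proof (rule eq_matI)
    fix i j assume "i < dim_row (1\<^sub>m n :: real mat)" "j < dim_col (1\<^sub>m n :: real mat)"
    then have ij: "i < n" "j < n" by auto
    have "(W\<^sup>T * W) $$ (i, j) = s i * s j * (ws ! i \<bullet> ws ! j)"
      using W ij cw[OF ij(1)] cw[OF ij(2)] by (simp add: col)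
    also have "\<dots> = 1\<^sub>m n $$ (i, j)"
      using orth[OF ij] s[OF ij(1)] ij by (cases "i = j") auto
    finally show "(W\<^sup>T * W) $$ (i, j) = 1\<^sub>m n $$ (i, j)" .
  qed (use W in auto)
  with W col[of 0] n hd_ws show ?thesis by auto
qed

text \<open>The fundamental theorem of algebra gives a complex eigenvalue \<open>k\<close> with
  eigenvector $v = a + ib$. Symmetry forces \<open>Im k = 0\<close>, and then whichever of the real
  vectors \<open>a\<close>, \<open>b\<close> is nonzero is an eigenvector.\<close>

lemma ex_real_eigenvalue_symmetric:
  fixes A :: "real mat"
  assumes A: "A \<in> carrier_mat n n" and sym: "A\<^sup>T = A" and n: "n \<noteq> 0"
  shows "\<exists>e. eigenvalue A e"
proof -
  define C where "C = map_mat complex_of_real A"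
  have C: "C \<in> carrier_mat n n" using A by (auto simp: C_def)
  have "degree (char_poly C) = n" using degree_monic_char_poly[OF C] by auto
  then have "\<not> constant (poly (char_poly C))" using n by (simp add: constant_degree)
  then obtain k where "poly (char_poly C) k = 0"
    using fundamental_theorem_of_algebra by blast
  then have "eigenvalue C k" using eigenvalue_root_char_poly[OF C] by simp
  then obtain v where "eigenvector C v k" by (auto simp: eigenvalue_def)
  then have v: "v \<in> carrier_vec n" "v \<noteq> 0\<^sub>v n" "C *\<^sub>v v = k \<cdot>\<^sub>v v"
    using C by (auto simp: eigenvector_def)
  define a b where "a = map_vec Re v" and "b = map_vec Im v"
  have ab: "a \<in> carrier_vec n" "b \<in> carrier_vec n" using v by (auto simp: a_def b_def)
  \<comment> \<open>The eigenvalue equation by coordinates. As the entries of \<open>A\<close> are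
    real, its real and imaginary parts give \<open>Aa\<close> and \<open>Ab\<close>.\<close>
  have *: "(\<Sum>j\<in>{0..<n}. complex_of_real (A $$ (i, j)) * v $ j) = k * v $ i" if "i < n" for i
    using arg_cong[OF v(3), of "\<lambda>w. w $ i"] that v(1) A
    by (simp add: C_def scalar_prod_def)
  have Aa: "A *\<^sub>v a = Re k \<cdot>\<^sub>v a - Im k \<cdot>\<^sub>v b"
  proof (rule eq_vecI)
    fix i assume "i < dim_vec (Re k \<cdot>\<^sub>v a - Im k \<cdot>\<^sub>v b)"
    then have "i < n" using ab by auto
    then show "(A *\<^sub>v a) $ i = (Re k \<cdot>\<^sub>v a - Im k \<cdot>\<^sub>v b) $ i"
      using arg_cong[OF *[OF \<open>i < n\<close>], of Re] A v(1)
      by (simp add: a_def b_def scalar_prod_def)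
  qed (use A ab in auto)
  have Ab: "A *\<^sub>v b = Re k \<cdot>\<^sub>v b + Im k \<cdot>\<^sub>v a"
  proof (rule eq_vecI)
    fix i assume "i < dim_vec (Re k \<cdot>\<^sub>v b + Im k \<cdot>\<^sub>v a)"
    then have "i < n" using ab by auto
    then show "(A *\<^sub>v b) $ i = (Re k \<cdot>\<^sub>v b + Im k \<cdot>\<^sub>v a) $ i"
      using arg_cong[OF *[OF \<open>i < n\<close>], of Im] A v(1)
      by (simp add: a_def b_def scalar_prod_def)
  qed (use A ab in auto)
  \<comment> \<open>After substitution of \<open>Aa\<close> and \<open>Ab\<close> the terms with
    \<open>Re k\<close> cancel, and those with \<open>Im k\<close> add up to a multiple of $|a|^2 +
    |b|^2$.\<close>
  have "b \<bullet> (A *\<^sub>v a) = a \<bullet> (A *\<^sub>v b)"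
    using transpose_vec_mult_scalar[OF A ab] sym A ab
    by (metis comm_scalar_prod mult_mat_vec_carrier)
  then have "Im k * (a \<bullet> a + b \<bullet> b) = 0"
    unfolding Aa Ab using ab comm_scalar_prod[OF ab]
    by (simp add: scalar_prod_minus_distrib[of _ n] scalar_prod_add_distrib[of _ n] algebra_simps)
  moreover have ne: "a \<noteq> 0\<^sub>v n \<or> b \<noteq> 0\<^sub>v n"
  proof (rule ccontr)
    assume "\<not> ?thesis"
    then have "map_vec Re v = 0\<^sub>v n" "map_vec Im v = 0\<^sub>v n" by (auto simp: a_def b_def)
    then have "map_vec Re v $ i = 0" "map_vec Im v $ i = 0" if "i < n" for i
      using that by simp_all
    then have "v $ i = 0" if "i < n" for i
      using that v(1) by (simp add: complex_eq_iff)
    then have "v = 0\<^sub>v n" using v(1) by (auto intro!: eq_vecI)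
    then show False using v(2) by simp
  qed
  moreover have "a \<bullet> a + b \<bullet> b > 0"
    using ne scalar_prod_self_pos[OF ab(1)] scalar_prod_self_pos[OF ab(2)]
      scalar_prod_self_nonneg[of a] scalar_prod_self_nonneg[of b]
    by linarith
  ultimately have "Im k = 0" by simp
  then have "A *\<^sub>v a = Re k \<cdot>\<^sub>v a" "A *\<^sub>v b = Re k \<cdot>\<^sub>v b"
    unfolding Aa Ab using ab by (auto intro!: eq_vecI)
  with ne ab A show ?thesis
    by (auto simp: eigenvalue_def eigenvector_def)
qed

text \<open>Spectral theorem by deflation: in an orthonormal basis that starts with an eigenvector,
  the matrix splits into a 1 by 1 block and a symmetric block of size \<open>n\<close>, to which the
  induction hypothesis applies.\<close>

lemma symmetric_diagonalizable:
  fixes A :: "real mat"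
  assumes "A \<in> carrier_mat n n" and "A\<^sup>T = A"
  shows "\<exists>P \<in> carrier_mat n n. \<exists>d. P\<^sup>T * P = 1\<^sub>m n \<and>
    P\<^sup>T * A * P = mat n n (\<lambda>(i, j). if i = j then d i else 0)"
  using assms
proof (induction n arbitrary: A)
  case 0
  then show ?case by (intro bexI[of _ "1\<^sub>m 0"]) (auto intro!: eq_matI)
next
  case (Suc n)
  note A = Suc.prems(1) and sym = Suc.prems(2)
  obtain e where "eigenvalue A e" using ex_real_eigenvalue_symmetric[OF A sym] by blast
  then obtain v where "eigenvector A v e" by (auto simp: eigenvalue_def)
  then have v: "v \<in> carrier_vec (Suc n)" "v \<noteq> 0\<^sub>v (Suc n)" "A *\<^sub>v v = e \<cdot>\<^sub>v v"
    using A by (auto simp: eigenvector_def)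
  obtain W c where W: "W \<in> carrier_mat (Suc n) (Suc n)" and WW: "W\<^sup>T * W = 1\<^sub>m (Suc n)"
    and col0: "col W 0 = c \<cdot>\<^sub>v v"
    using ex_orthogonal_mat_with_first_col[OF v(1,2)] by blast
  define B where "B = W\<^sup>T * A * W"
  have B: "B \<in> carrier_mat (Suc n) (Suc n)" using W A by (auto simp: B_def)
  have symB: "B\<^sup>T = B"
    unfolding B_def using W A sym
    by (simp add: transpose_mult[of _ "Suc n" "Suc n" _ "Suc n"] assoc_mult_mat[of _ "Suc n" "Suc n" _ "Suc n" _ "Suc n"])
  \<comment> \<open>The first column of \<open>W\<close> is still an eigenvector, so the first
    column of \<open>B\<close> is \<open>e\<close> times that of \<open>W\<^sup>T * W\<close>, the
    identity.\<close>
  have B0: "B $$ (i, 0) = (if i = 0 then e else 0)" if i: "i < Suc n" for i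
  proof -
    have "A *\<^sub>v col W 0 = e \<cdot>\<^sub>v col W 0"
      unfolding col0 using v A by (simp add: mult_mat_vec[of _ "Suc n" "Suc n"] smult_smult_assoc mult.commute)
    moreover have "B $$ (i, 0) = col W i \<bullet> (A *\<^sub>v col W 0)"
      unfolding B_def using W A i
      by (subst assoc_mult_mat[of _ "Suc n" "Suc n" _ "Suc n" _ "Suc n"]) (auto simp: col_mult2[of _ "Suc n" "Suc n"] mult_mat_vec_def)
    ultimately have "B $$ (i, 0) = e * (W\<^sup>T * W) $$ (i, 0)" using W i by simp
    then show ?thesis unfolding WW using i by simp
  qed
  define A3 where "A3 = mat n n (\<lambda>(i, j). B $$ (Suc i, Suc j))"
  have A3: "A3 \<in> carrier_mat n n" by (simp add: A3_def)
  have Bij: "B $$ (i, j) = B $$ (j, i)" if "i < Suc n" "j < Suc n" for i j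
    using arg_cong[OF symB, of "\<lambda>M. M $$ (j, i)"] B that by simp
  have "A3\<^sup>T = A3" unfolding A3_def using Bij by (auto intro!: eq_matI)
  then obtain P d where P: "P \<in> carrier_mat n n" and PP: "P\<^sup>T * P = 1\<^sub>m n"
    and PAP: "P\<^sup>T * A3 * P = mat n n (\<lambda>(i, j). if i = j then d i else 0)"
    using Suc.IH[OF A3] by blast
  define E where "E = mat 1 1 (\<lambda>_. e)"
  define Q where "Q = four_block_mat (1\<^sub>m 1) (0\<^sub>m 1 n) (0\<^sub>m n 1) P"
  \<comment> \<open>By symmetry the first row of \<open>B\<close> vanishes off the diagonal as
    well.\<close>
  have B_block: "B = four_block_mat E (0\<^sub>m 1 n) (0\<^sub>m n 1) A3"
    using B B0 Bij by (auto intro!: eq_matI simp: E_def A3_def)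
  have Q: "Q \<in> carrier_mat (Suc n) (Suc n)"
    unfolding Q_def using four_block_carrier_mat[of "1\<^sub>m 1" 1 1 P n n] P by simp
  have E: "E \<in> carrier_mat 1 1" by (simp add: E_def)
  have QT: "Q\<^sup>T = four_block_mat (1\<^sub>m 1) (0\<^sub>m 1 n) (0\<^sub>m n 1) (P\<^sup>T)"
    unfolding Q_def using P by (subst transpose_four_block_mat) auto
  have PT: "P\<^sup>T \<in> carrier_mat n n" using P by simp
  have QQ: "Q\<^sup>T * Q = 1\<^sub>m (Suc n)"
    unfolding QT unfolding Q_def
    using P PT PP by (subst mult_four_block_mat) auto
  have "Q\<^sup>T * B * Q = four_block_mat E (0\<^sub>m 1 n) (0\<^sub>m n 1) (P\<^sup>T * A3 * P)"
    unfolding QT B_block unfolding Q_def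
    using P PT A3 E
    by (simp add: mult_four_block_mat[of _ 1 1 _ n _ n _ _ 1 _ n])
  also have "\<dots> = mat (Suc n) (Suc n) (\<lambda>(i, j). if i = j then (case i of 0 \<Rightarrow> e | Suc k \<Rightarrow> d k) else 0)"
    unfolding PAP by (rule eq_matI) (auto simp: E_def split: nat.splits)
  finally have QBQ: "Q\<^sup>T * B * Q = \<dots>" .
  note assoc = assoc_mult_mat[of _ "Suc n" "Suc n" _ "Suc n" _ "Suc n"]
  have T: "(W * Q)\<^sup>T = Q\<^sup>T * W\<^sup>T" using W Q by (simp add: transpose_mult)
  have "(W * Q)\<^sup>T * (W * Q) = Q\<^sup>T * (W\<^sup>T * W) * Q"
    unfolding T using W Q by (simp add: assoc)
  then have "(W * Q)\<^sup>T * (W * Q) = 1\<^sub>m (Suc n)" using WW QQ Q by simp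
  moreover have "(W * Q)\<^sup>T * A * (W * Q) = Q\<^sup>T * B * Q"
    unfolding T B_def using W Q A by (simp add: assoc)
  ultimately show ?case using QBQ W Q
    by (intro bexI[of _ "W * Q"] exI[of _ "\<lambda>i. case i of 0 \<Rightarrow> e | Suc k \<Rightarrow> d k"]) auto
qed

text \<open>The vectors \<open>p i\<close> are the columns of the diagonalising matrix, listed in
  the order of \<open>nth_eigenvalue\<close>. The later arguments use this orthonormal eigenbasis
  only through the two sums of squares.\<close>

lemma symmetric_quadratic_form:
  fixes A :: "real mat"
  assumes A: "A \<in> carrier_mat n n" and sym: "A\<^sup>T = A"
  obtains p where "\<forall>i<n. p i \<in> carrier_vec n"
    and "\<forall>x\<in>carrier_vec n. x \<bullet> x = (\<Sum>i<n. (p i \<bullet> x)\<^sup>2)"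
    and "\<forall>x\<in>carrier_vec n.
      x \<bullet> (A *\<^sub>v x) = (\<Sum>i<n. nth_eigenvalue A (Suc i) * (p i \<bullet> x)\<^sup>2)"
    and "\<forall>i j. i \<le> j \<longrightarrow> j < n \<longrightarrow> nth_eigenvalue A (Suc j) \<le> nth_eigenvalue A (Suc i)"
proof -
  define L where "L = rev (sorted_list_of_multiset (proots (char_poly A)))"
  have nth_L: "nth_eigenvalue A (Suc i) = L ! i" for i
    by (simp add: nth_eigenvalue_def L_def)
  obtain P d where P: "P \<in> carrier_mat n n" and PP: "P\<^sup>T * P = 1\<^sub>m n"
    and PAP: "P\<^sup>T * A * P = mat n n (\<lambda>(i, j). if i = j then d i else 0)"
    using symmetric_diagonalizable[OF A sym] by blast
  define D where "D = mat n n (\<lambda>(i, j). if i = j then d i else 0)"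
  have D: "D \<in> carrier_mat n n" by (simp add: D_def)
  have PT: "P\<^sup>T \<in> carrier_mat n n" using P by simp
  have PP': "P * P\<^sup>T = 1\<^sub>m n" using mat_mult_left_right_inverse[OF PT P PP] .
  have "P * D * P\<^sup>T = (P * P\<^sup>T) * A * (P * P\<^sup>T)"
    unfolding D_def PAP[symmetric] using P PT A
    by (simp add: assoc_mult_mat[of _ n n _ n _ n])
  then have A_eq: "A = P * D * P\<^sup>T" unfolding PP' using A by simp
  \<comment> \<open>Similar matrices share the characteristic polynomial, and that of
    \<open>D\<close> splits over the reals. So the real roots listed by
    \<open>nth_eigenvalue\<close> are exactly the entries \<open>d i\<close> with
    multiplicity.\<close>
  have "similar_mat A D"
    unfolding similar_mat_def
    using similar_mat_witI[OF PP' PP A_eq A D P PT] by blast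
  then have "char_poly A = char_poly D" by (rule char_poly_similar)
  also have "\<dots> = (\<Prod>a\<leftarrow>diag_mat D. [:- a, 1:])"
    by (rule char_poly_upper_triangular[OF D]) (auto simp: D_def)
  also have "diag_mat D = map d [0..<n]" by (auto simp: diag_mat_def D_def)
  finally have "char_poly A = (\<Prod>a\<leftarrow>map d [0..<n]. [:- a, 1:])" .
  moreover have "proots (\<Prod>a\<leftarrow>as. [:- a, 1:]) = mset as" for as :: "real list"
  proof (induction as)
    case (Cons a as)
    have "(\<Prod>a\<leftarrow>as. [:- a, 1:]) \<noteq> 0" by (auto simp: prod_list_zero_iff)
    then show ?case using Cons by (simp add: proots_mult del: mult_pCons_left)
  qed simp
  ultimately have mset_L: "mset L = mset (map d [0..<n])"
    by (simp only: L_def mset_rev mset_sorted_list_of_multiset)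
  \<comment> \<open>The entries \<open>d i\<close> come in no particular order; \<open>f\<close>
    sorts them into the decreasing list \<open>L\<close>, and the columns of \<open>P\<close> are
    relabelled along with them.\<close>
  then obtain f where "f permutes {..<length (map d [0..<n])}" and "permute_list f (map d [0..<n]) = L"
    by (rule mset_eq_permutation)
  then have f: "f permutes {..<n}" and L_eq: "L = permute_list f (map d [0..<n])" by simp_all
  have f_less: "f i < n" if "i < n" for i using permutes_in_image[OF f] that by simp
  have L_f: "L ! i = d (f i)" if "i < n" for i
    using that f_less[OF that] by (simp add: L_eq permute_list_def)
  have reindex: "(\<Sum>i<n. g (f i)) = (\<Sum>i<n. g i)" for g :: "nat \<Rightarrow> real"
    using sum.permute[OF f, of g] by (simp add: o_def)
  have sq: "x \<bullet> x = (\<Sum>i<n. (col P (f i) \<bullet> x)\<^sup>2)"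
    and form: "x \<bullet> (A *\<^sub>v x) = (\<Sum>i<n. nth_eigenvalue A (Suc i) * (col P (f i) \<bullet> x)\<^sup>2)"
    if x: "x \<in> carrier_vec n" for x
  proof -
    \<comment> \<open>The coordinates of \<open>x\<close> in the eigenbasis.\<close>
    define y where "y = P\<^sup>T *\<^sub>v x"
    have y: "y \<in> carrier_vec n" unfolding y_def by (rule mult_mat_vec_carrier[OF PT x])
    have y_nth: "y $ i = col P i \<bullet> x" if "i < n" for i using that P by (simp add: y_def)
    have "x \<bullet> x = x \<bullet> (P *\<^sub>v y)"
      unfolding y_def using x P PT PP' by (simp flip: assoc_mult_mat_vec[of P n n _ n])
    also have "\<dots> = y \<bullet> y"
      using transpose_vec_mult_scalar[OF P y x] by (simp add: y_def)
    also have "\<dots> = (\<Sum>i<n. (y $ i)\<^sup>2)"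
      using y by (simp add: scalar_prod_def power2_eq_square atLeast0LessThan)
    also have "\<dots> = (\<Sum>i<n. (col P i \<bullet> x)\<^sup>2)" by (simp add: y_nth)
    finally show "x \<bullet> x = (\<Sum>i<n. (col P (f i) \<bullet> x)\<^sup>2)"
      using reindex[of "\<lambda>i. (col P i \<bullet> x)\<^sup>2"] by simp
    have Dy: "D *\<^sub>v y \<in> carrier_vec n" using D y by simp
    have Dy_nth: "(D *\<^sub>v y) $ i = d i * y $ i" if "i < n" for i
    proof -
      have "(D *\<^sub>v y) $ i = (\<Sum>j\<in>{0..<n}. (if i = j then d i else 0) * y $ j)"
        using that y by (simp add: D_def scalar_prod_def)
      also have "\<dots> = (\<Sum>j\<in>{0..<n}. if i = j then d i * y $ j else 0)"
        by (rule sum.cong) auto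
      finally show ?thesis using that by simp
    qed
    have "x \<bullet> (A *\<^sub>v x) = x \<bullet> (P *\<^sub>v (D *\<^sub>v y))"
      unfolding A_eq y_def using x P D PT by (simp add: assoc_mult_mat_vec[of _ n n _ n])
    also have "\<dots> = y \<bullet> (D *\<^sub>v y)"
      using transpose_vec_mult_scalar[OF P Dy x] by (simp add: y_def)
    also have "\<dots> = (\<Sum>i<n. y $ i * (D *\<^sub>v y) $ i)"
      using Dy D by (simp add: scalar_prod_def atLeast0LessThan)
    also have "\<dots> = (\<Sum>i<n. d i * (col P i \<bullet> x)\<^sup>2)"
      by (rule sum.cong) (auto simp: Dy_nth y_nth power2_eq_square)
    also have "\<dots> = (\<Sum>i<n. d (f i) * (col P (f i) \<bullet> x)\<^sup>2)"
      by (rule reindex[symmetric])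
    finally show "x \<bullet> (A *\<^sub>v x) = (\<Sum>i<n. nth_eigenvalue A (Suc i) * (col P (f i) \<bullet> x)\<^sup>2)"
      by (simp add: nth_L L_f)
  qed
  show thesis
  proof (rule that[of "\<lambda>i. col P (f i)"]; intro ballI allI impI)
    fix i j assume ij: "i \<le> j" "j < n"
    have "length L = n" using arg_cong[OF mset_L, of size] by simp
    moreover have "sorted (rev L)" by (simp add: L_def)
    ultimately show "nth_eigenvalue A (Suc j) \<le> nth_eigenvalue A (Suc i)"
      unfolding nth_L using ij by (simp add: sorted_rev_nth_mono)
  qed (use f_less P sq form in auto)
qed

section \<open>Dimension counting and variational bounds for the ordered eigenvalues\<close>

text \<open>Fewer than \<open>n\<close> homogeneous equations in \<open>n\<close> unknowns have a
  nonzero solution: padded with zero rows, the system becomes square and singular.\<close>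

lemma ex_nonzero_common_zero:
  fixes fs :: "'a :: field vec list"
  assumes fs: "set fs \<subseteq> carrier_vec n" and len: "length fs < n"
  shows "\<exists>x \<in> carrier_vec n. x \<noteq> 0\<^sub>v n \<and> (\<forall>f \<in> set fs. f \<bullet> x = 0)"
proof -
  define gs where "gs = fs @ replicate (n - length fs) (0\<^sub>v n)"
  define M where "M = mat_of_rows n gs"
  have gs: "length gs = n" "set gs \<subseteq> carrier_vec n" using fs len by (auto simp: gs_def)
  have M: "M \<in> carrier_mat n n" using gs by (auto simp: M_def)
  have row: "row M i = gs ! i" if "i < n" for i
    unfolding M_def using that gs by (simp add: subset_code(1))
  have "\<not> n - 1 < length fs" using len by simp
  then have row0: "row M (n - 1) = 0\<^sub>v n" using len row[of "n - 1"] by (simp add: gs_def nth_append)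
  have "M $$ (n - 1, i) = 0" if "i < n" for i
    using arg_cong[OF row0, of "\<lambda>w. w $ i"] that M len by simp
  \<comment> \<open>The last row of \<open>M\<close> is padding, so the last unit vector lies in the
    kernel of the transpose, which makes the determinant vanish.\<close>
  then have "M\<^sup>T *\<^sub>v unit_vec n (n - 1) = 0\<^sub>v n"
    using M len by (intro eq_vecI) auto
  moreover have "unit_vec n (n - 1) \<noteq> (0\<^sub>v n :: 'a vec)" using len by simp
  ultimately have "det (M\<^sup>T) = 0"
    using det_0_iff_vec_prod_zero_field[of "M\<^sup>T" n] M by (auto intro: unit_vec_carrier)
  then have "det M = 0" using det_transpose[OF M] by simp
  then obtain x where x: "x \<in> carrier_vec n" "x \<noteq> 0\<^sub>v n" "M *\<^sub>v x = 0\<^sub>v n"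
    using det_0_iff_vec_prod_zero_field[OF M] by blast
  have "f \<bullet> x = 0" if "f \<in> set fs" for f
  proof -
    from that obtain i where i: "i < length fs" "f = fs ! i" by (auto simp: in_set_conv_nth)
    then have "f = row M i" using row[of i] len by (simp add: gs_def nth_append)
    then show ?thesis using arg_cong[OF x(3), of "\<lambda>w. w $ i"] i len M by simp
  qed
  with x show ?thesis by blast
qed

text \<open>
  The fewer than $j$ conditions in \<open>fs\<close> and the $n - j$ conditions of orthogonality to the eigenvectors
  beyond the $j$-th one leave a nonzero vector, on which the form is at least $\lambda_j |x|^2$.
\<close>

lemma nth_eigenvalue_le:
  fixes A :: "real mat"
  assumes A: "A \<in> carrier_mat n n" "A\<^sup>T = A"
    and fs: "set fs \<subseteq> carrier_vec n" and len: "length fs < j" and j: "j \<le> n"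
    and le: "\<And>x. x \<in> carrier_vec n \<Longrightarrow> (\<And>f. f \<in> set fs \<Longrightarrow> f \<bullet> x = 0) \<Longrightarrow>
      x \<bullet> (A *\<^sub>v x) \<le> c * (x \<bullet> x)"
  shows "nth_eigenvalue A j \<le> c"
proof -
  obtain p where p: "\<forall>i<n. p i \<in> carrier_vec n"
    and sq: "\<forall>x\<in>carrier_vec n. x \<bullet> x = (\<Sum>i<n. (p i \<bullet> x)\<^sup>2)"
    and form: "\<forall>x\<in>carrier_vec n.
      x \<bullet> (A *\<^sub>v x) = (\<Sum>i<n. nth_eigenvalue A (Suc i) * (p i \<bullet> x)\<^sup>2)"
    and mono: "\<forall>i j. i \<le> j \<longrightarrow> j < n \<longrightarrow> nth_eigenvalue A (Suc j) \<le> nth_eigenvalue A (Suc i)"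
    by (rule symmetric_quadratic_form[OF A])
  have "set (fs @ map p [j..<n]) \<subseteq> carrier_vec n" "length (fs @ map p [j..<n]) < n"
    using fs p len j by (auto dest: bspec)
  from ex_nonzero_common_zero[OF this] obtain x where x: "x \<in> carrier_vec n" "x \<noteq> 0\<^sub>v n"
    and fx: "\<And>f. f \<in> set fs \<Longrightarrow> f \<bullet> x = 0" and px: "\<And>i. j \<le> i \<Longrightarrow> i < n \<Longrightarrow> p i \<bullet> x = 0"
    by auto
  have "nth_eigenvalue A j * (x \<bullet> x) = (\<Sum>i<n. nth_eigenvalue A j * (p i \<bullet> x)\<^sup>2)"
    using sq[rule_format, OF x(1)] by (simp add: sum_distrib_left)
  also have "\<dots> \<le> (\<Sum>i<n. nth_eigenvalue A (Suc i) * (p i \<bullet> x)\<^sup>2)"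
  proof (rule sum_mono)
    \<comment> \<open>For \<open>i < j\<close> the ordering of the eigenvalues applies, with
      \<open>Suc (j - 1) = j\<close> since \<open>j\<close> is positive; for the other
      \<open>i\<close> both sides vanish by the choice of \<open>x\<close>.\<close>
    fix i assume "i \<in> {..<n}"
    then show "nth_eigenvalue A j * (p i \<bullet> x)\<^sup>2 \<le> nth_eigenvalue A (Suc i) * (p i \<bullet> x)\<^sup>2"
      using mono[rule_format, of i "j - 1"] px[of i] len j
      by (cases "i < j") (auto intro!: mult_right_mono)
  qed
  also have "\<dots> = x \<bullet> (A *\<^sub>v x)" using form[rule_format, OF x(1)] by simp
  also have "\<dots> \<le> c * (x \<bullet> x)" using le[OF x(1) fx] .
  finally show ?thesis using scalar_prod_self_pos[OF x] by simp
qed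

text \<open>To the conditions \<open>fs\<close> add orthogonality to the first \<open>m\<close>
  eigenvectors of \<open>B\<close>. On what remains the form of \<open>B\<close>, hence that of
  \<open>A\<close>, is at most $|x|^2$ times the next eigenvalue of \<open>B\<close>, and
  \<open>nth_eigenvalue_le\<close> applies.\<close>

lemma nth_eigenvalue_le_shifted:
  fixes A B :: "real mat"
  assumes A: "A \<in> carrier_mat n n" "A\<^sup>T = A" and B: "B \<in> carrier_mat n n" "B\<^sup>T = B"
    and fs: "set fs \<subseteq> carrier_vec n" and len: "length fs < j" and j: "j \<le> n"
    and le: "\<And>x. x \<in> carrier_vec n \<Longrightarrow> (\<And>f. f \<in> set fs \<Longrightarrow> f \<bullet> x = 0) \<Longrightarrow>
      x \<bullet> (A *\<^sub>v x) \<le> x \<bullet> (B *\<^sub>v x)"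
  shows "nth_eigenvalue A j \<le> nth_eigenvalue B (j - length fs)"
proof -
  obtain p where p: "\<forall>i<n. p i \<in> carrier_vec n"
    and sq: "\<forall>x\<in>carrier_vec n. x \<bullet> x = (\<Sum>i<n. (p i \<bullet> x)\<^sup>2)"
    and form: "\<forall>x\<in>carrier_vec n.
      x \<bullet> (B *\<^sub>v x) = (\<Sum>i<n. nth_eigenvalue B (Suc i) * (p i \<bullet> x)\<^sup>2)"
    and mono: "\<forall>i j. i \<le> j \<longrightarrow> j < n \<longrightarrow> nth_eigenvalue B (Suc j) \<le> nth_eigenvalue B (Suc i)"
    by (rule symmetric_quadratic_form[OF B])
  \<comment> \<open>The largest \<open>m\<close> allowed: together with \<open>fs\<close> it makes
    \<open>j - 1\<close> conditions, just below the bound \<open>j\<close>.\<close>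
  define m where "m = j - length fs - 1"
  have m: "Suc m = j - length fs" using len by (simp add: m_def)
  show ?thesis
  proof (rule nth_eigenvalue_le[OF A, where fs = "fs @ map p [0..<m]"])
    show "set (fs @ map p [0..<m]) \<subseteq> carrier_vec n" using fs p m j by auto
    show "length (fs @ map p [0..<m]) < j" using m by auto
    show "j \<le> n" by (rule j)
    fix x assume x: "x \<in> carrier_vec n"
      and zero: "\<And>f. f \<in> set (fs @ map p [0..<m]) \<Longrightarrow> f \<bullet> x = 0"
    have "x \<bullet> (A *\<^sub>v x) \<le> x \<bullet> (B *\<^sub>v x)" using le[OF x] zero by simp
    also have "\<dots> = (\<Sum>i<n. nth_eigenvalue B (Suc i) * (p i \<bullet> x)\<^sup>2)" by (rule form[rule_format, OF x])
    also have "\<dots> \<le> (\<Sum>i<n. nth_eigenvalue B (Suc m) * (p i \<bullet> x)\<^sup>2)"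
    proof (rule sum_mono)
      \<comment> \<open>The terms with \<open>i < m\<close> vanish by the added conditions; the
        eigenvalues of the others are at most the one at \<open>Suc m\<close>.\<close>
      fix i assume "i \<in> {..<n}"
      then show "nth_eigenvalue B (Suc i) * (p i \<bullet> x)\<^sup>2 \<le> nth_eigenvalue B (Suc m) * (p i \<bullet> x)\<^sup>2"
        using mono[rule_format, of m i] zero[of "p i"]
        by (cases "i < m") (auto intro!: mult_right_mono)
    qed
    finally show "x \<bullet> (A *\<^sub>v x) \<le> nth_eigenvalue B (j - length fs) * (x \<bullet> x)"
      using sq[rule_format, OF x] m by (simp add: sum_distrib_left)
  qed
qed

text \<open>A Rayleigh quotient is a weighted average of the eigenvalues, so it cannot exceed the
  largest.\<close>

lemma nth_eigenvalue_1_ge: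
  fixes A :: "real mat"
  assumes A: "A \<in> carrier_mat n n" "A\<^sup>T = A" and x: "x \<in> carrier_vec n" "x \<noteq> 0\<^sub>v n"
    and ge: "x \<bullet> (A *\<^sub>v x) \<ge> c * (x \<bullet> x)"
  shows "nth_eigenvalue A 1 \<ge> c"
proof -
  obtain p where "\<forall>i<n. p i \<in> carrier_vec n"
    and sq: "\<forall>x\<in>carrier_vec n. x \<bullet> x = (\<Sum>i<n. (p i \<bullet> x)\<^sup>2)"
    and form: "\<forall>x\<in>carrier_vec n.
      x \<bullet> (A *\<^sub>v x) = (\<Sum>i<n. nth_eigenvalue A (Suc i) * (p i \<bullet> x)\<^sup>2)"
    and mono: "\<forall>i j. i \<le> j \<longrightarrow> j < n \<longrightarrow> nth_eigenvalue A (Suc j) \<le> nth_eigenvalue A (Suc i)"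
    by (rule symmetric_quadratic_form[OF A])
  have "c * (x \<bullet> x) \<le> (\<Sum>i<n. nth_eigenvalue A (Suc i) * (p i \<bullet> x)\<^sup>2)"
    using ge form[rule_format, OF x(1)] by simp
  also have "\<dots> \<le> (\<Sum>i<n. nth_eigenvalue A 1 * (p i \<bullet> x)\<^sup>2)"
    using mono[rule_format, of 0] by (intro sum_mono mult_right_mono) auto
  also have "\<dots> = nth_eigenvalue A 1 * (x \<bullet> x)" using sq[rule_format, OF x(1)] by (simp add: sum_distrib_left)
  finally show ?thesis using scalar_prod_self_pos[OF x] by simp
qed

section \<open>The quadratic form of the regularised walk and the effect of deleting edges\<close>

lemma regularised_walk_mat_carrier [simp]:
  "regularised_walk_mat \<delta> vs E \<in> carrier_mat (length vs) (length vs)"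
  by (rule carrier_matI) (simp_all add: regularised_walk_mat_def adjacency_mat_def degree_mat_def)

lemma regularised_walk_mat_transpose [simp]:
  "(regularised_walk_mat \<delta> vs E)\<^sup>T = regularised_walk_mat \<delta> vs E"
  by (rule eq_matI)
    (auto simp: regularised_walk_mat_def adjacency_mat_def degree_mat_def insert_commute)

text \<open>The sum runs over ordered pairs, so every edge is counted twice.\<close>

definition dirichlet_form :: "'v list \<Rightarrow> 'v set set \<Rightarrow> real vec \<Rightarrow> real" where
  "dirichlet_form vs E x =
    (\<Sum>i<length vs. \<Sum>j<length vs. if {vs ! i, vs ! j} \<in> E then (x $ i - x $ j)\<^sup>2 else 0)"

lemma dirichlet_form_nonneg: "dirichlet_form vs E x \<ge> 0"
  by (auto simp: dirichlet_form_def intro!: sum_nonneg)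

lemma dirichlet_form_mono: "F \<subseteq> E \<Longrightarrow> dirichlet_form vs F x \<le> dirichlet_form vs E x"
  by (auto simp: dirichlet_form_def intro!: sum_mono)

lemma vdegree_eq_sum:
  assumes "finite_simple_graph V E" "distinct vs" "set vs = V"
  shows "real (vdegree E u) = (\<Sum>j<length vs. if {u, vs ! j} \<in> E then 1 else 0)"
proof -
  have "finite V" using assms(1) by (simp add: finite_simple_graph_def)
  then have "real (vdegree E u) = (\<Sum>v\<in>V. if {u, v} \<in> E then 1 else 0)"
    unfolding vdegree_eq_card_neighbours[OF assms(1)]
    by (simp add: sum.If_cases Int_def)
  also have "\<dots> = (\<Sum>j<length vs. if {u, vs ! j} \<in> E then 1 else 0)"
    using sum.reindex_bij_betw[OF bij_betw_nth[OF assms(2) refl assms(3)[symmetric]],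
        of "\<lambda>v. if {u, v} \<in> E then 1 else 0 :: real"] by simp
  finally show ?thesis .
qed

lemma regularised_walk_quadratic_form:
  assumes "finite_simple_graph V E" "distinct vs" "set vs = V" "\<delta> \<ge> 1"
    and x: "x \<in> carrier_vec (length vs)"
  shows "x \<bullet> (regularised_walk_mat \<delta> vs E *\<^sub>v x) = x \<bullet> x - dirichlet_form vs E x / (2 * real \<delta>)"
proof -
  define n where "n = length vs"
  define a where "a i j = (if {vs ! i, vs ! j} \<in> E then 1 else 0 :: real)" for i j
  have a_sym: "a i j = a j i" for i j by (simp add: a_def insert_commute)
  have deg: "real (vdegree E (vs ! i)) = (\<Sum>j<n. a i j)" for i
    unfolding a_def n_def by (rule vdegree_eq_sum[OF assms(1-3)])
  have \<delta>: "real \<delta> > 0" using assms(4) by simp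
  have nth: "(regularised_walk_mat \<delta> vs E *\<^sub>v x) $ i = x $ i + (\<Sum>j<n. a i j * (x $ j - x $ i)) / real \<delta>"
    if i: "i < n" for i
  proof -
    have "(regularised_walk_mat \<delta> vs E *\<^sub>v x) $ i =
      (\<Sum>j<n. a i j * x $ j / real \<delta> + (if i = j then (1 - vdegree E (vs ! i) / real \<delta>) * x $ j else 0))"
      using i x \<delta>
      by (auto simp: regularised_walk_mat_def adjacency_mat_def degree_mat_def scalar_prod_def
          n_def a_def atLeast0LessThan field_simps intro!: sum.cong)
    also have "\<dots> = (\<Sum>j<n. a i j * x $ j / real \<delta>) + (1 - vdegree E (vs ! i) / real \<delta>) * x $ i"
      using i by (simp add: sum.distrib)
    also have "\<dots> = x $ i + (\<Sum>j<n. a i j * (x $ j - x $ i)) / real \<delta>"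
      unfolding deg
      by (simp add: sum_subtractf sum_distrib_right[symmetric] sum_divide_distrib[symmetric]
          right_diff_distrib left_diff_distrib diff_divide_distrib)
    finally show ?thesis .
  qed
  define S where "S = (\<Sum>i<n. \<Sum>j<n. a i j * (x $ i * (x $ j - x $ i)))"
  \<comment> \<open>Exchange the names of \<open>i\<close> and \<open>j\<close>; adding both
    expressions for \<open>S\<close> turns each summand into $-a_{ij} (x_i - x_j)^2$.\<close>
  have "S = (\<Sum>i<n. \<Sum>j<n. a i j * (x $ j * (x $ i - x $ j)))"
    unfolding S_def by (subst sum.swap) (simp add: a_sym)
  then have "2 * S = (\<Sum>i<n. \<Sum>j<n. a i j * (x $ i * (x $ j - x $ i)) + a i j * (x $ j * (x $ i - x $ j)))"
    unfolding sum.distrib by (simp add: S_def)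
  also have "\<dots> = - dirichlet_form vs E x"
    unfolding dirichlet_form_def n_def sum_negf[symmetric]
    by (intro sum.cong) (auto simp: a_def power2_eq_square algebra_simps)
  finally have S: "S = - dirichlet_form vs E x / 2" by simp
  have "x \<bullet> (regularised_walk_mat \<delta> vs E *\<^sub>v x) =
    (\<Sum>i<n. x $ i * (x $ i + (\<Sum>j<n. a i j * (x $ j - x $ i)) / real \<delta>))"
    using carrier_matD[OF regularised_walk_mat_carrier[of \<delta> vs E]]
    by (auto simp: scalar_prod_def atLeast0LessThan n_def[symmetric] nth simp del: index_mult_mat_vec intro!: sum.cong)
  also have "\<dots> = x \<bullet> x + S / real \<delta>"
    using x by (simp add: S_def scalar_prod_def n_def[symmetric] atLeast0LessThan distrib_left sum.distrib
        sum_divide_distrib sum_distrib_left mult_ac)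
  finally show ?thesis using S by (simp add: field_simps)
qed

lemma dirichlet_form_removed:
  assumes "\<And>i j. i < length vs \<Longrightarrow> j < length vs \<Longrightarrow> {vs ! i, vs ! j} \<in> R \<Longrightarrow> x $ i = x $ j"
  shows "dirichlet_form vs (E - R) x = dirichlet_form vs E x"
  unfolding dirichlet_form_def using assms by (intro sum.cong) auto

text \<open>A deleted edge with ends at positions \<open>k e\<close> and \<open>l e\<close>
  contributes the difference of two unit vectors, whose product with \<open>x\<close> is the
  difference of the values of \<open>x\<close> at the ends. The orientation is an arbitrary
  choice.\<close>

lemma ex_edge_functionals:
  assumes "finite_simple_graph V E" "R \<subseteq> E" "distinct vs" "set vs = V"
  obtains fs :: "real vec list" where "set fs \<subseteq> carrier_vec (length vs)" "length fs = card R"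
    and "\<And>x i j. x \<in> carrier_vec (length vs) \<Longrightarrow> (\<And>f. f \<in> set fs \<Longrightarrow> f \<bullet> x = 0) \<Longrightarrow>
      i < length vs \<Longrightarrow> j < length vs \<Longrightarrow> {vs ! i, vs ! j} \<in> R \<Longrightarrow> x $ i = x $ j"
proof -
  let ?n = "length vs"
  have "finite R"
    using assms(1,2) by (auto simp: finite_simple_graph_def intro: finite_subset[of R "Pow V"])
  then obtain es where es: "set es = R" "distinct es" using finite_distinct_list by blast
  have "\<exists>k l. k < ?n \<and> l < ?n \<and> e = {vs ! k, vs ! l}" if "e \<in> R" for e
  proof -
    have "card e = 2" "e \<subseteq> V" using that assms(1,2) by (auto simp: finite_simple_graph_def)
    then obtain u v where "e = {u, v}" "u \<in> set vs" "v \<in> set vs"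
      using assms(4) by (auto simp: card_2_iff)
    then show ?thesis by (metis in_set_conv_nth)
  qed
  then obtain k l where kl: "\<And>e. e \<in> R \<Longrightarrow> k e < ?n \<and> l e < ?n \<and> e = {vs ! k e, vs ! l e}"
    by metis
  define f where "f e = unit_vec ?n (k e) - (unit_vec ?n (l e) :: real vec)" for e
  show thesis
  proof (rule that[of "map f es"])
    show "set (map f es) \<subseteq> carrier_vec ?n" by (auto simp: f_def)
    show "length (map f es) = card R" using es by (metis distinct_card length_map)
    fix x i j
    assume x: "x \<in> carrier_vec ?n" and zero: "\<And>g. g \<in> set (map f es) \<Longrightarrow> g \<bullet> x = 0"
      and ij: "i < ?n" "j < ?n" "{vs ! i, vs ! j} \<in> R"
    let ?e = "{vs ! i, vs ! j}"
    have "f ?e \<bullet> x = 0" using zero ij es by auto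
    then have "x $ k ?e = x $ l ?e"
      using kl[OF ij(3)] x by (simp add: f_def minus_scalar_prod_distrib[of _ ?n])
    moreover have "i = k ?e \<and> j = l ?e \<or> i = l ?e \<and> j = k ?e"
      using kl[OF ij(3)] ij(1,2) assms(3) by (metis doubleton_eq_iff nth_eq_iff_index_eq)
    ultimately show "x $ i = x $ j" by auto
  qed
qed

section \<open>Comparison of the two spectra\<close>

theorem theorem1p8:
  fixes V :: "'v set" and E R :: "'v set set" and vs :: "'v list"
    and \<delta> N r j :: nat and A A' :: "real mat" and \<beta> \<beta>' :: "nat \<Rightarrow> real"
  assumes "finite_simple_graph V E"
    and "N = card V"
    and "\<delta> = max_degree V E" and "\<delta> \<ge> 1"
    and "R \<subseteq> E" and "r = card R"
    and "distinct vs" and "set vs = V"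
    and "A = regularised_walk_mat \<delta> vs E"
    and "A' = regularised_walk_mat \<delta> vs (E - R)"
    and "\<beta> = nth_eigenvalue A" and "\<beta>' = nth_eigenvalue A'"
    and "j \<in> {1..N}"
  shows "\<beta> j \<le> \<beta>' j \<and> \<beta>' j \<le> \<beta> (max (j - r) 1)"
proof -
  have N: "length vs = N" using assms distinct_card by metis
  have j: "0 < j" "j \<le> N" using assms by auto
  have A: "A \<in> carrier_mat N N" "A\<^sup>T = A" and A': "A' \<in> carrier_mat N N" "A'\<^sup>T = A'"
    using assms N regularised_walk_mat_carrier by (metis, simp, metis, simp)
  have E': "finite_simple_graph V (E - R)" using assms(1) by (auto simp: finite_simple_graph_def)
  have form: "x \<bullet> (A *\<^sub>v x) = x \<bullet> x - dirichlet_form vs E x / (2 * real \<delta>)"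
    and form': "x \<bullet> (A' *\<^sub>v x) = x \<bullet> x - dirichlet_form vs (E - R) x / (2 * real \<delta>)"
    if "x \<in> carrier_vec N" for x
    using regularised_walk_quadratic_form[OF assms(1,7,8,4)]
      regularised_walk_quadratic_form[OF E' assms(7,8,4)] that assms(9,10) N by auto
  obtain fs :: "real vec list" where fs: "set fs \<subseteq> carrier_vec N" "length fs = r"
    and edge: "\<And>x i j. x \<in> carrier_vec N \<Longrightarrow> (\<And>f. f \<in> set fs \<Longrightarrow> f \<bullet> x = 0) \<Longrightarrow>
      i < N \<Longrightarrow> j < N \<Longrightarrow> {vs ! i, vs ! j} \<in> R \<Longrightarrow> x $ i = x $ j"
    using ex_edge_functionals[OF assms(1,5,7,8)] N assms(6) by metis
  \<comment> \<open>The forms are comparable on the whole space, so the list of conditions is empty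
    and the index does not shift.\<close>
  have "nth_eigenvalue A j \<le> nth_eigenvalue A' (j - length ([] :: real vec list))"
  proof (rule nth_eigenvalue_le_shifted[OF A A' _ _ j(2)])
    fix x :: "real vec" assume "x \<in> carrier_vec N"
    then show "x \<bullet> (A *\<^sub>v x) \<le> x \<bullet> (A' *\<^sub>v x)"
      using dirichlet_form_mono[of "E - R" E vs x] by (simp add: form form' divide_right_mono)
  qed (use j in auto)
  then have lower: "\<beta> j \<le> \<beta>' j" using assms by simp
  have upper: "nth_eigenvalue A' j \<le> nth_eigenvalue A (max (j - r) 1)"
  proof (cases "r < j")
    case True
    have "nth_eigenvalue A' j \<le> nth_eigenvalue A (j - length fs)"
    proof (rule nth_eigenvalue_le_shifted[OF A' A fs(1) _ j(2)])
      fix x assume x: "x \<in> carrier_vec N" and zero: "\<And>f. f \<in> set fs \<Longrightarrow> f \<bullet> x = 0"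
      have "dirichlet_form vs (E - R) x = dirichlet_form vs E x"
        using edge[OF x zero] N by (intro dirichlet_form_removed) auto
      then show "x \<bullet> (A' *\<^sub>v x) \<le> x \<bullet> (A *\<^sub>v x)" by (simp add: form[OF x] form'[OF x])
    qed (use True fs in auto)
    moreover have "max (j - r) 1 = j - r" using True by simp
    ultimately show ?thesis using fs by simp
  next
    case False
    \<comment> \<open>Here \<open>j - r\<close> truncates to 0, so the index on the right is 1 and
      the number 1 separates the two eigenvalues.\<close>
    have "nth_eigenvalue A' j \<le> 1"
      by (rule nth_eigenvalue_le[OF A', of "[]"])
        (use j form' dirichlet_form_nonneg[of vs "E - R"] in auto)
    also have "1 \<le> nth_eigenvalue A 1"
    proof (rule nth_eigenvalue_1_ge[OF A])
      let ?x = "vec N (\<lambda>_. 1 :: real)"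
      show x: "?x \<in> carrier_vec N" by simp
      show "?x \<noteq> 0\<^sub>v N" using j by (auto dest: arg_cong[of _ _ "\<lambda>w. w $ 0"])
      have "dirichlet_form vs E ?x = 0" by (auto simp: dirichlet_form_def N intro!: sum.neutral)
      then show "1 * (?x \<bullet> ?x) \<le> ?x \<bullet> (A *\<^sub>v ?x)" using form[OF x] by simp
    qed
    finally show ?thesis using False by simp
  qed
  with lower show ?thesis using assms by simp
qed

end
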